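(* Let $d\ge2$ and let $G$ be a random matrix with values in $GL(d,\mathbb{R})$ with a random singular value decomposition $G=U\,\mathrm{Diag}(\sigma_1,\sigma_2,\dots,\sigma_d)\,V$, and let $u_1\in\mathbb{R}^d$ be the (random) first column of $U$. Suppose that there is a constant $\delta>0$ such that for every unit vector $x\in\mathbb{R}^d$, $$2\,\mathbb{E}\left[\left|\ln(|\langle u_1,x\rangle|)\right|\right]\le\mathbb{E}[\ln(\sigma_1/\sigma_2)]-\delta.$$ Then $$\sup_{x\neq y}\mathbb{E}\left[\ln\left(\frac{\|Gx\wedge Gy\|}{\|x\wedge y\|\,\|Gx\|\,\|Gy\|}\right)\right]\le-\delta,$$ where $x,y$ are unit vectors in $\mathbb{R}^d$.
   Context: $\|\cdot\|$ is the Euclidean norm (also on $\wedge^2\mathbb{R}^d$, so $\|x\wedge y\|$ is the area of the parallelogram spanned by $x,y$). In the random singular value decomposition, $U$ and $V$ are random orthogonal matrices and $\sigma_1\ge\sigma_2\ge\dots\ge\sigma_d>0$ are the random singular values, all defined on the same probability space as $G$. In the supremum, $x\neq y$ is understood as $x$ and $y$ having distinct directions, so that $\|x\wedge y\|\neq0$.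
   Formalization: As printed the claim fails (V=I, constant singular values, U Haar). Here u_1, the first column of U, is replaced by the first row of V, and E|ln|<.,x>|| is required to be finite for every unit x, excluding the degenerate reading "infinity <= infinity - delta". *)

theory Defs
  imports "HOL-Probability.Probability"
begin

text \<open>
  Coordinates are indexed by a finite linearly ordered type, so that ``first column'' and the
  ordering of the singular values make sense; the dimension is \<open>d = CARD('n)\<close>.
\<close>

definition idx1 :: "'n::{finite,linorder}" where
  "idx1 = Min UNIV"

text \<open>Only meaningful if \<open>CARD('n) \<ge> 2\<close>.\<close>

definition idx2 :: "'n::{finite,linorder}" where
  "idx2 = Min (UNIV - {idx1})"

definition Diag :: "real^'n \<Rightarrow> real^'n^'n" where
  "Diag s = (\<chi> i j. if i = j then s $ i else 0)"

text \<open>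
  The bivector \<open>x \<and> y\<close> is represented by the antisymmetric matrix of its coordinates: the entry
  \<open>(i, j)\<close> with \<open>i < j\<close> is the coefficient of \<open>e\<^sub>i \<and> e\<^sub>j\<close>.
\<close>

definition wedge :: "real^'n \<Rightarrow> real^'n \<Rightarrow> real^'n^'n" where
  "wedge x y = (\<chi> i j. x $ i * y $ j - x $ j * y $ i)"

text \<open>
  The Euclidean norm for which the \<open>e\<^sub>i \<and> e\<^sub>j\<close> with \<open>i < j\<close> are orthonormal. The norm of the matrix
  type is the Frobenius norm, which counts every coordinate twice.
\<close>

definition bivector_norm :: "real^'n^'n \<Rightarrow> real" where
  "bivector_norm w = norm w / sqrt 2"

lemma bivector_norm_wedge:
  "(bivector_norm (wedge x y))\<^sup>2 = (norm x)\<^sup>2 * (norm y)\<^sup>2 - (x \<bullet> y)\<^sup>2"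
proof -
  have fro: "(norm (wedge x y))\<^sup>2 = (\<Sum>i\<in>UNIV. \<Sum>j\<in>UNIV. (x $ i * y $ j - x $ j * y $ i)\<^sup>2)"
    unfolding power2_norm_eq_inner
    by (simp add: inner_vec_def wedge_def power2_eq_square)
  have swap: "(\<Sum>i\<in>UNIV. \<Sum>j\<in>UNIV. (y $ i * y $ i) * (x $ j * x $ j))
            = (\<Sum>i\<in>UNIV. \<Sum>j\<in>UNIV. (x $ i * x $ i) * (y $ j * y $ j))"
    by (subst sum.swap) (simp add: mult.commute)
  have "(\<Sum>i\<in>UNIV. \<Sum>j\<in>UNIV. (x $ i * y $ j - x $ j * y $ i)\<^sup>2)
          = (\<Sum>i\<in>UNIV. \<Sum>j\<in>UNIV. (x $ i * x $ i) * (y $ j * y $ j))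
            + (\<Sum>i\<in>UNIV. \<Sum>j\<in>UNIV. (y $ i * y $ i) * (x $ j * x $ j))
            - 2 * (\<Sum>i\<in>UNIV. \<Sum>j\<in>UNIV. (x $ i * y $ i) * (x $ j * y $ j))"
    by (simp add: sum_distrib_left sum.distrib [symmetric] sum_subtractf [symmetric]
        power2_eq_square algebra_simps)
  also have "\<dots> = 2 * ((x \<bullet> x) * (y \<bullet> y) - (x \<bullet> y)\<^sup>2)"
    unfolding swap by (simp add: inner_vec_def sum_product power2_eq_square algebra_simps)
  finally show ?thesis
    using fro by (simp add: bivector_norm_def power_divide power2_norm_eq_inner)
qed

text \<open>The logarithm on \<open>[0, \<infinity>)\<close> with \<open>ln 0 = -\<infinity>\<close>, whereas the library has \<^term>\<open>ln (0::real) = 0\<close>.\<close>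

definition eln :: "real \<Rightarrow> ereal" where
  "eln t = (if t > 0 then ereal (ln t) else - \<infinity>)"

text \<open>
  The expectation in the extended sense \<open>E f = E f\<^sup>+ - E f\<^sup>-\<close>, needed because the library's
  Bochner integral is \<open>0\<close> for functions that are not integrable. It is the usual expectation as soon
  as one of the two parts is finite; as \<open>\<infinity> - \<infinity> = \<infinity>\<close> in \<^typ>\<open>ereal\<close>, an upper bound below \<open>\<infinity>\<close>
  includes the claim that the positive part is integrable.
\<close>

definition eexpectation :: "'w measure \<Rightarrow> ('w \<Rightarrow> ereal) \<Rightarrow> ereal" where
  "eexpectation M f =
     enn2ereal (\<integral>\<^sup>+\<omega>. e2ennreal (f \<omega>) \<partial>M) - enn2ereal (\<integral>\<^sup>+\<omega>. e2ennreal (- f \<omega>) \<partial>M)"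

text \<open>
  As \<open>\<parallel>G x\<parallel> \<ge> \<sigma>\<^sub>1 \<bar>\<langle>v\<^sub>1, x\<rangle>\<bar>\<close> where \<open>v\<^sub>1\<close> is the first row of \<open>V\<close>, that row is the singular direction which
  controls how \<open>G\<close> contracts \<open>x\<close>; the first column of \<open>U\<close> plays the same role for the transpose
  of \<open>G\<close>, and carries no information about \<open>\<parallel>G x\<parallel>\<close>.
\<close>

definition random_svd ::
  "'w measure \<Rightarrow> ('w \<Rightarrow> real^'n::{finite,linorder}^'n::{finite,linorder})
     \<Rightarrow> ('w \<Rightarrow> real^'n::{finite,linorder}^'n::{finite,linorder})
     \<Rightarrow> ('w \<Rightarrow> real^'n::{finite,linorder})
     \<Rightarrow> ('w \<Rightarrow> real^'n::{finite,linorder}^'n::{finite,linorder}) \<Rightarrow> bool" where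
  "random_svd M G U \<sigma> V \<longleftrightarrow>
     U \<in> borel_measurable M \<and> \<sigma> \<in> borel_measurable M \<and> V \<in> borel_measurable M \<and>
     (\<forall>\<omega>\<in>space M.
        orthogonal_matrix (U \<omega>) \<and> orthogonal_matrix (V \<omega>) \<and>
        (\<forall>i. 0 < \<sigma> \<omega> $ i) \<and> (\<forall>i j. i \<le> j \<longrightarrow> \<sigma> \<omega> $ j \<le> \<sigma> \<omega> $ i) \<and>
        G \<omega> = U \<omega> ** Diag (\<sigma> \<omega>) ** V \<omega>)"

end

theory Submission
  imports Defs
begin

text \<open>
  The point is a deterministic inequality. Let \<open>v\<^sub>1\<close> be the first row of \<open>V\<close>. Orthogonal maps
  preserve the length of vectors and the area of parallelograms, so only the diagonal factor of
  \<open>G = U Diag \<sigma> V\<close> matters. It multiplies the coordinate along \<open>e\<^sub>1\<close> by \<open>\<sigma>\<^sub>1\<close>, whence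
  \<open>\<parallel>G x\<parallel> \<ge> \<sigma>\<^sub>1 \<bar>\<langle>v\<^sub>1, x\<rangle>\<bar>\<close> (\<open>norm_svd_ge\<close>), and it multiplies the coordinate along \<open>e\<^sub>i \<and> e\<^sub>j\<close> by
  \<open>\<sigma>\<^sub>i \<sigma>\<^sub>j \<le> \<sigma>\<^sub>1 \<sigma>\<^sub>2\<close>, whence \<open>\<parallel>G x \<and> G y\<parallel> \<le> \<sigma>\<^sub>1 \<sigma>\<^sub>2 \<parallel>x \<and> y\<parallel>\<close> (\<open>bivector_norm_svd_le\<close>).
  Together,
  \<open>ln (\<parallel>G x \<and> G y\<parallel> / (\<parallel>x \<and> y\<parallel> \<parallel>G x\<parallel> \<parallel>G y\<parallel>)) \<le> \<bar>ln \<bar>\<langle>v\<^sub>1, x\<rangle>\<bar>\<bar> + \<bar>ln \<bar>\<langle>v\<^sub>1, y\<rangle>\<bar>\<bar> - ln (\<sigma>\<^sub>1 / \<sigma>\<^sub>2)\<close>.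
  Taking expectations and applying half of the hypothesis at \<open>x\<close> and half at \<open>y\<close> gives the bound.

  The expectation of \<open>ln (\<sigma>\<^sub>1 / \<sigma>\<^sub>2)\<close> may be infinite, and the logarithms take the value \<open>-\<infinity>\<close> where
  \<open>\<langle>v\<^sub>1, x\<rangle> = 0\<close>. So the passage to expectations (\<open>eexpectation_le_diff\<close>) separates positive and
  negative parts and works with nonnegative integrals; the finiteness of the expectations of
  \<open>\<bar>ln \<bar>\<langle>v\<^sub>1, x\<rangle>\<bar>\<bar>\<close> is what makes the positive part of the left-hand side integrable.
\<close>

section \<open>Extended expectations\<close>

lemma eexpectation_nonneg_eq:
  assumes "\<And>\<omega>. \<omega> \<in> space M \<Longrightarrow> 0 \<le> f \<omega>"
  shows "eexpectation M f = enn2ereal (\<integral>\<^sup>+\<omega>. e2ennreal (f \<omega>) \<partial>M)"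
proof -
  have "(\<integral>\<^sup>+\<omega>. e2ennreal (- f \<omega>) \<partial>M) = (\<integral>\<^sup>+\<omega>. 0 \<partial>M)"
    by (rule nn_integral_cong) (use assms in \<open>auto simp: e2ennreal_neg\<close>)
  then show ?thesis
    by (simp add: eexpectation_def zero_ennreal.rep_eq)
qed

lemma eexpectation_nonneg:
  assumes "\<And>\<omega>. \<omega> \<in> space M \<Longrightarrow> 0 \<le> f \<omega>"
  shows "0 \<le> eexpectation M f"
  using assms by (simp add: eexpectation_nonneg_eq)

lemma eexpectation_add_nonneg:
  assumes "f \<in> borel_measurable M" "g \<in> borel_measurable M"
    and "\<And>\<omega>. \<omega> \<in> space M \<Longrightarrow> 0 \<le> f \<omega>" "\<And>\<omega>. \<omega> \<in> space M \<Longrightarrow> 0 \<le> g \<omega>"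
  shows "eexpectation M (\<lambda>\<omega>. f \<omega> + g \<omega>) = eexpectation M f + eexpectation M g"
proof -
  have "(\<integral>\<^sup>+\<omega>. e2ennreal (f \<omega> + g \<omega>) \<partial>M)
      = (\<integral>\<^sup>+\<omega>. e2ennreal (f \<omega>) + e2ennreal (g \<omega>) \<partial>M)"
    by (rule nn_integral_cong) (use assms in \<open>simp add: plus_ennreal.abs_eq eq_onp_def\<close>)
  also have "\<dots> = (\<integral>\<^sup>+\<omega>. e2ennreal (f \<omega>) \<partial>M) + (\<integral>\<^sup>+\<omega>. e2ennreal (g \<omega>) \<partial>M)"
    using assms by (intro nn_integral_add) auto
  finally show ?thesis
    using assms by (simp add: eexpectation_nonneg_eq plus_ennreal.rep_eq)
qed

text \<open>
  The form \<open>g + f\<^sup>+ \<le> f\<^sup>- + h\<close> of \<open>f + g \<le> h\<close> has no negative terms and can be integrated as it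
  stands, whatever values are infinite.
\<close>

lemma e2ennreal_parts_le:
  fixes f g h :: ereal
  assumes "f + g \<le> h" "0 \<le> g" "0 \<le> h"
  shows "e2ennreal g + e2ennreal f \<le> e2ennreal (- f) + e2ennreal h"
proof (cases "0 \<le> f")
  case True
  have "e2ennreal g + e2ennreal f = e2ennreal (f + g)"
    using True assms by (simp add: plus_ennreal.abs_eq eq_onp_def add.commute)
  also have "\<dots> \<le> e2ennreal h"
    using assms by (intro e2ennreal_mono) auto
  finally show ?thesis
    using True by (simp add: e2ennreal_neg)
next
  case False
  have "g \<le> - f + h"
    using False assms by (cases f; cases g; cases h) auto
  then have "e2ennreal g \<le> e2ennreal (- f + h)"
    by (rule e2ennreal_mono)
  also have "\<dots> = e2ennreal (- f) + e2ennreal h"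
    using False assms by (simp add: plus_ennreal.abs_eq eq_onp_def)
  finally show ?thesis
    using False by (simp add: e2ennreal_neg)
qed

text \<open>
  Integrability of \<open>h\<close> bounds the positive part of \<open>f\<close>, so that \<open>\<infinity> - \<infinity>\<close> cannot occur. If the
  expectation of \<open>g\<close> is infinite, then so is that of the negative part of \<open>f\<close>, and both sides are
  \<open>-\<infinity>\<close>.
\<close>

lemma eexpectation_le_diff:
  assumes [measurable]: "f \<in> borel_measurable M" "g \<in> borel_measurable M" "h \<in> borel_measurable M"
    and g: "\<And>\<omega>. \<omega> \<in> space M \<Longrightarrow> 0 \<le> g \<omega>"
    and h: "\<And>\<omega>. \<omega> \<in> space M \<Longrightarrow> 0 \<le> h \<omega>"
    and le: "\<And>\<omega>. \<omega> \<in> space M \<Longrightarrow> f \<omega> + g \<omega> \<le> h \<omega>"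
    and fin: "eexpectation M h < \<infinity>"
  shows "eexpectation M f \<le> eexpectation M h - eexpectation M g"
proof -
  define P where "P = (\<integral>\<^sup>+\<omega>. e2ennreal (f \<omega>) \<partial>M)"
  define N where "N = (\<integral>\<^sup>+\<omega>. e2ennreal (- f \<omega>) \<partial>M)"
  define I where "I = (\<integral>\<^sup>+\<omega>. e2ennreal (g \<omega>) \<partial>M)"
  define J where "J = (\<integral>\<^sup>+\<omega>. e2ennreal (h \<omega>) \<partial>M)"
  have "I + P = (\<integral>\<^sup>+\<omega>. e2ennreal (g \<omega>) + e2ennreal (f \<omega>) \<partial>M)"
    unfolding I_def P_def by (rule nn_integral_add[symmetric]) auto
  also have "\<dots> \<le> (\<integral>\<^sup>+\<omega>. e2ennreal (- f \<omega>) + e2ennreal (h \<omega>) \<partial>M)"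
    by (intro nn_integral_mono e2ennreal_parts_le le g h)
  also have "\<dots> = N + J"
    unfolding N_def J_def by (rule nn_integral_add) auto
  finally have IP: "I + P \<le> N + J" .
  have "f \<omega> \<le> h \<omega>" if "\<omega> \<in> space M" for \<omega>
    using le[OF that] g[OF that] add_left_mono[of 0 "g \<omega>" "f \<omega>"] by simp
  then have PJ: "P \<le> J"
    unfolding P_def J_def by (intro nn_integral_mono e2ennreal_mono)
  have Ef: "eexpectation M f = enn2ereal P - enn2ereal N"
    by (simp add: eexpectation_def P_def N_def)
  have Eg: "eexpectation M g = enn2ereal I" and Eh: "eexpectation M h = enn2ereal J"
    unfolding I_def J_def by (intro eexpectation_nonneg_eq g h; simp)+
  have IP': "enn2ereal I + enn2ereal P \<le> enn2ereal N + enn2ereal J"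
    using IP by (simp add: less_eq_ennreal.rep_eq plus_ennreal.rep_eq)
  have PJ': "enn2ereal P \<le> enn2ereal J"
    using PJ by (simp add: less_eq_ennreal.rep_eq)
  have nn: "0 \<le> enn2ereal P" "0 \<le> enn2ereal N" "0 \<le> enn2ereal I" "0 \<le> enn2ereal J"
    by simp_all
  show ?thesis
    using IP' PJ' nn fin unfolding Ef Eg Eh
    by (cases "enn2ereal P"; cases "enn2ereal N"; cases "enn2ereal I"; cases "enn2ereal J") auto
qed

lemma borel_measurable_eln [measurable]: "eln \<in> borel_measurable borel"
  unfolding eln_def by measurable

section \<open>Singular values and the action on bivectors\<close>

lemma inner_orthogonal_matrix_mult:
  fixes Q :: "real^'n^'n"
  assumes "orthogonal_matrix Q"
  shows "(Q *v a) \<bullet> (Q *v b) = a \<bullet> b"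
  using assms orthogonal_transformation_matrix[of "(*v) Q"]
  by (simp add: orthogonal_transformation_def)

lemma norm_orthogonal_matrix_mult:
  fixes Q :: "real^'n^'n"
  assumes "orthogonal_matrix Q"
  shows "norm (Q *v a) = norm a"
  using inner_orthogonal_matrix_mult[OF assms] by (simp add: norm_eq_sqrt_inner)

lemma bivector_norm_nonneg: "0 \<le> bivector_norm w"
  by (simp add: bivector_norm_def)

lemma bivector_norm_orthogonal_matrix_mult:
  fixes Q :: "real^'n^'n"
  assumes "orthogonal_matrix Q"
  shows "bivector_norm (wedge (Q *v a) (Q *v b)) = bivector_norm (wedge a b)"
  using bivector_norm_nonneg
  by (rule power2_eq_imp_eq[rotated])
    (simp_all add: bivector_norm_nonneg bivector_norm_wedge norm_orthogonal_matrix_mult[OF assms]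
      inner_orthogonal_matrix_mult[OF assms])

lemma Diag_mult_nth: "(Diag s *v a) $ i = s $ i * a $ i"
  by (simp add: Diag_def matrix_vector_mult_def if_distrib[of "\<lambda>c. c * _"] cong: if_cong)

lemma idx1_le: "idx1 \<le> i"
  by (simp add: idx1_def)

lemma idx2_le: "i \<noteq> idx1 \<Longrightarrow> idx2 \<le> i"
  by (simp add: idx2_def)

lemma prod_singular_values_le:
  fixes s :: "real^'n::{finite,linorder}"
  assumes pos: "\<And>i. 0 < s $ i" and anti: "\<And>i j. i \<le> j \<Longrightarrow> s $ j \<le> s $ i" and "i \<noteq> j"
  shows "s $ i * s $ j \<le> s $ idx1 * s $ idx2"
proof (cases "i = idx1")
  case True
  then show ?thesis
    using assms by (auto intro!: mult_left_mono anti idx2_le less_imp_le[OF pos])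
next
  case False
  then have "s $ i * s $ j \<le> s $ idx2 * s $ idx1"
    by (intro mult_mono anti idx1_le idx2_le) (auto intro: less_imp_le[OF pos])
  then show ?thesis
    by (simp add: mult.commute)
qed

text \<open>
  In the coordinates of \<^const>\<open>wedge\<close> the diagonal matrix acts diagonally, with eigenvalue
  \<open>s\<^sub>i s\<^sub>j\<close> at \<open>(i, j)\<close>; the entries with \<open>i = j\<close>, for which this product may exceed
  \<open>s\<^sub>1 s\<^sub>2\<close>, vanish.
\<close>

lemma bivector_norm_Diag_le:
  fixes s :: "real^'n::{finite,linorder}"
  assumes pos: "\<And>i. 0 < s $ i" and anti: "\<And>i j. i \<le> j \<Longrightarrow> s $ j \<le> s $ i"
  shows "bivector_norm (wedge (Diag s *v a) (Diag s *v b))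
    \<le> s $ idx1 * s $ idx2 * bivector_norm (wedge a b)"
proof -
  let ?c = "s $ idx1 * s $ idx2"
  have c: "0 \<le> ?c"
    by (simp add: less_imp_le pos)
  have entry: "norm (wedge (Diag s *v a) (Diag s *v b) $ i $ j) \<le> norm ((?c *\<^sub>R wedge a b) $ i $ j)"
    for i j
  proof (cases "i = j")
    case False
    have "wedge (Diag s *v a) (Diag s *v b) $ i $ j = (s $ i * s $ j) * wedge a b $ i $ j"
      by (simp add: wedge_def Diag_mult_nth algebra_simps)
    moreover have "\<bar>s $ i * s $ j\<bar> * \<bar>wedge a b $ i $ j\<bar> \<le> ?c * \<bar>wedge a b $ i $ j\<bar>"
      using prod_singular_values_le[OF pos anti False] pos[of i] pos[of j]
      by (intro mult_right_mono) (auto simp: abs_mult)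
    ultimately show ?thesis
      by (simp add: abs_mult abs_of_pos[OF pos])
  qed (simp add: wedge_def)
  have "norm (wedge (Diag s *v a) (Diag s *v b)) \<le> norm (?c *\<^sub>R wedge a b)"
    by (intro norm_le_componentwise_cart entry)
  then show ?thesis
    using c by (simp add: bivector_norm_def divide_right_mono)
qed

lemma bivector_norm_svd_le:
  fixes s :: "real^'n::{finite,linorder}"
  assumes "orthogonal_matrix P" "orthogonal_matrix Q"
    and "\<And>i. 0 < s $ i" "\<And>i j. i \<le> j \<Longrightarrow> s $ j \<le> s $ i"
  shows "bivector_norm (wedge ((P ** Diag s ** Q) *v x) ((P ** Diag s ** Q) *v y))
    \<le> s $ idx1 * s $ idx2 * bivector_norm (wedge x y)"
  using bivector_norm_Diag_le[OF assms(3,4), of "Q *v x" "Q *v y"] assms(1,2)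
  by (simp add: matrix_vector_mul_assoc[symmetric] bivector_norm_orthogonal_matrix_mult)

lemma norm_svd_ge:
  assumes "orthogonal_matrix P" "0 < s $ i"
  shows "s $ i * \<bar>row i Q \<bullet> x\<bar> \<le> norm ((P ** Diag s ** Q) *v x)"
proof -
  have "s $ i * \<bar>row i Q \<bullet> x\<bar> = \<bar>(Diag s *v (Q *v x)) $ i\<bar>"
    using assms(2)
    by (simp add: Diag_mult_nth matrix_vector_mul_component[of Q] row_def abs_mult vec_lambda_eta)
  also have "\<dots> \<le> norm (Diag s *v (Q *v x))"
    by (rule component_le_norm_cart)
  also have "\<dots> = norm ((P ** Diag s ** Q) *v x)"
    using assms(1) by (simp add: matrix_vector_mul_assoc[symmetric] norm_orthogonal_matrix_mult)
  finally show ?thesis .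
qed

section \<open>The logarithmic contraction estimate\<close>

text \<open>
  The two estimates of the previous part enter as the bounds on \<open>W\<close> and on \<open>X\<close>, \<open>Y\<close>. If \<open>a\<close> or \<open>b\<close>
  is zero then the right-hand side is infinite, and if the ratio is not positive then the first
  term is \<open>-\<infinity>\<close> while the second is finite.
\<close>

lemma eln_ratio_le:
  fixes W w X Y s t a b :: real
  assumes W: "W \<le> s * t * w" and X: "s * a \<le> X" and Y: "s * b \<le> Y"
    and pos: "0 < s" "0 < t" "0 \<le> w" and nonneg: "0 \<le> a" "0 \<le> b"
  shows "eln (W / (w * X * Y)) + eln (s / t) \<le> \<bar>eln a\<bar> + \<bar>eln b\<bar>"
proof (cases "0 < a \<and> 0 < b \<and> 0 < W / (w * X * Y)")
  case True
  then have a: "0 < a" and b: "0 < b" and r: "0 < W / (w * X * Y)"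
    by auto
  have XY: "0 < X" "0 < Y"
    using X Y a b pos by (smt (verit) mult_pos_pos)+
  have w: "0 < w"
    using r pos by (cases "w = 0") auto
  have "W * (s * a * b) \<le> (s * t * w) * (s * a * b)"
    using W a b pos by (intro mult_right_mono) auto
  also have "\<dots> = (t * w) * ((s * a) * (s * b))"
    by (simp add: algebra_simps)
  also have "\<dots> \<le> (t * w) * (X * Y)"
    using X Y XY a b pos w by (intro mult_left_mono mult_mono) auto
  finally have le: "W / (w * X * Y) * (s / t) * (a * b) \<le> 1"
    using XY w pos by (simp add: field_simps)
  define r where "r = W / (w * X * Y)"
  define q where "q = s / t"
  have rq: "0 < r" "0 < q" "r * q * (a * b) \<le> 1"
    using r pos le by (simp_all add: r_def q_def)
  have "ln r + ln q + (ln a + ln b) = ln (r * q * (a * b))"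
    using rq a b by (simp add: ln_mult_pos)
  also have "\<dots> \<le> 0"
    using rq a b by simp
  finally have "ln r + ln q \<le> \<bar>ln a\<bar> + \<bar>ln b\<bar>"
    by linarith
  then show ?thesis
    unfolding r_def[symmetric] q_def[symmetric] using rq a b by (simp add: eln_def)
next
  case False
  then show ?thesis
    using nonneg pos by (auto simp: eln_def)
qed

theorem proposition4p6:
  fixes M :: "'w measure"
    and G U V :: "'w \<Rightarrow> real^'n::{finite,linorder}^'n::{finite,linorder}"
    and \<sigma> :: "'w \<Rightarrow> real^'n::{finite,linorder}"
    and v1 :: "'w \<Rightarrow> real^'n::{finite,linorder}"
    and \<delta> :: real
  assumes "prob_space M"
    and "CARD('n) \<ge> 2"
    and "G \<in> borel_measurable M"
    and "\<And>\<omega>. \<omega> \<in> space M \<Longrightarrow> invertible (G \<omega>)"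
    and "random_svd M G U \<sigma> V"
    and "\<And>\<omega>. v1 \<omega> = row idx1 (V \<omega>)"
    and "\<delta> > 0"
    and "\<And>x. norm x = 1 \<Longrightarrow>
           eexpectation M (\<lambda>\<omega>. \<bar>eln \<bar>v1 \<omega> \<bullet> x\<bar>\<bar>) < \<infinity> \<and>
           2 * eexpectation M (\<lambda>\<omega>. \<bar>eln \<bar>v1 \<omega> \<bullet> x\<bar>\<bar>)
             \<le> eexpectation M (\<lambda>\<omega>. eln (\<sigma> \<omega> $ idx1 / \<sigma> \<omega> $ idx2)) - ereal \<delta>"
  shows "(SUP (x, y) \<in> {(x, y). norm x = 1 \<and> norm y = 1 \<and> wedge x y \<noteq> 0}.
            eexpectation M (\<lambda>\<omega>. eln (bivector_norm (wedge (G \<omega> *v x) (G \<omega> *v y))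
                / (bivector_norm (wedge x y) * norm (G \<omega> *v x) * norm (G \<omega> *v y)))))
         \<le> - ereal \<delta>"

proof -
  let ?ratio = "\<lambda>x y \<omega>. bivector_norm (wedge (G \<omega> *v x) (G \<omega> *v y))
                / (bivector_norm (wedge x y) * norm (G \<omega> *v x) * norm (G \<omega> *v y))"
  let ?gap = "\<lambda>\<omega>. eln (\<sigma> \<omega> $ idx1 / \<sigma> \<omega> $ idx2)"
  let ?dir = "\<lambda>x \<omega>. \<bar>eln \<bar>v1 \<omega> \<bullet> x\<bar>\<bar>"
  have [measurable]: "G \<in> borel_measurable M" "\<sigma> \<in> borel_measurable M" "V \<in> borel_measurable M"
    using assms(3,5) by (auto simp: random_svd_def)
  have [measurable]: "(\<lambda>\<omega>. \<sigma> \<omega> $ i) \<in> borel_measurable M" for i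
    by (rule borel_measurable_continuous_on[OF _ \<open>\<sigma> \<in> _\<close>]) (intro continuous_intros)
  have [measurable]: "(\<lambda>\<omega>. G \<omega> *v x) \<in> borel_measurable M" for x
    by (rule borel_measurable_continuous_on[OF _ \<open>G \<in> _\<close>])
      (auto simp: matrix_vector_mult_def intro!: continuous_intros)
  have [measurable]: "v1 \<in> borel_measurable M"
  proof -
    have "(\<lambda>\<omega>. row idx1 (V \<omega>)) \<in> borel_measurable M"
      by (rule borel_measurable_continuous_on[OF _ \<open>V \<in> _\<close>])
        (auto simp: row_def intro!: continuous_intros)
    moreover have "v1 = (\<lambda>\<omega>. row idx1 (V \<omega>))"
      using assms(6) by (rule ext)
    ultimately show ?thesis
      by simp
  qed
  have [measurable]: "(\<lambda>\<omega>. bivector_norm (wedge (G \<omega> *v x) (G \<omega> *v y))) \<in> borel_measurable M" for x y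
    by (rule borel_measurable_continuous_on[OF _ \<open>G \<in> _\<close>])
      (auto simp: bivector_norm_def wedge_def matrix_vector_mult_def intro!: continuous_intros)
  have gap_measurable: "?gap \<in> borel_measurable M"
    by measurable
  have dir_measurable: "?dir x \<in> borel_measurable M" for x
    by measurable
  have svd: "orthogonal_matrix (U \<omega>)" "orthogonal_matrix (V \<omega>)" "\<And>i. 0 < \<sigma> \<omega> $ i"
      "\<And>i j. i \<le> j \<Longrightarrow> \<sigma> \<omega> $ j \<le> \<sigma> \<omega> $ i" "G \<omega> = U \<omega> ** Diag (\<sigma> \<omega>) ** V \<omega>"
    if "\<omega> \<in> space M" for \<omega>
    using assms(5) that by (auto simp: random_svd_def)
  have gap_nonneg: "0 \<le> ?gap \<omega>" if "\<omega> \<in> space M" for \<omega>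
    using svd(3)[OF that, of idx1] svd(3)[OF that, of idx2] svd(4)[OF that idx1_le, of idx2]
    by (simp add: eln_def)
  have "eexpectation M (\<lambda>\<omega>. eln (?ratio x y \<omega>)) \<le> - ereal \<delta>"
    if x: "norm x = 1" and y: "norm y = 1" for x y
  proof -
    have pointwise: "eln (?ratio x y \<omega>) + ?gap \<omega> \<le> ?dir x \<omega> + ?dir y \<omega>" if "\<omega> \<in> space M" for \<omega>
      using svd(1-4)[OF that] bivector_norm_nonneg unfolding svd(5)[OF that] assms(6)
      by (intro eln_ratio_le bivector_norm_svd_le norm_svd_ge) auto
    have sum: "eexpectation M (\<lambda>\<omega>. ?dir x \<omega> + ?dir y \<omega>) = eexpectation M (?dir x) + eexpectation M (?dir y)"
      by (intro eexpectation_add_nonneg dir_measurable) auto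
    have "eexpectation M (\<lambda>\<omega>. eln (?ratio x y \<omega>))
        \<le> eexpectation M (\<lambda>\<omega>. ?dir x \<omega> + ?dir y \<omega>) - eexpectation M ?gap"
    proof (rule eexpectation_le_diff)
      show "eexpectation M (\<lambda>\<omega>. ?dir x \<omega> + ?dir y \<omega>) < \<infinity>"
        using assms(8)[OF x] assms(8)[OF y] unfolding sum by simp
    qed (use pointwise gap_nonneg in \<open>auto simp: dir_measurable gap_measurable\<close>)
    moreover have "0 \<le> eexpectation M (?dir x)" "0 \<le> eexpectation M (?dir y)"
      by (intro eexpectation_nonneg; simp)+
    moreover have "0 \<le> eexpectation M ?gap"
      by (intro eexpectation_nonneg gap_nonneg)
    ultimately show ?thesis
      using assms(8)[OF x] assms(8)[OF y] unfolding sum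
      by (cases "eexpectation M (?dir x)"; cases "eexpectation M (?dir y)";
          cases "eexpectation M ?gap"; cases "eexpectation M (\<lambda>\<omega>. eln (?ratio x y \<omega>))") auto
  qed
  then show ?thesis
    by (intro SUP_least) auto
qed

end
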